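(* Let $\mathcal{H}$ be a real Hilbert space. For every $k=0,1,2,\ldots$, let $T_k\colon\mathcal{H}\to\mathcal{H}$ be nonexpansive and assume that $C\subseteq\bigcap_k\operatorname{Fix}T_k$ is nonempty, closed and convex. Given a summable sequence of positive numbers $\{\beta_k\}_{k=0}^\infty$ and a bounded sequence $\{v^k\}_{k=0}^\infty$ in $\mathcal{H}$, define for $x^0\in\mathcal{H}$ the sequence $\{x^k\}_{k=0}^\infty$ by $$x^{k+1}=T_k(x^k-\beta_kv^k).$$ Assume that for every $i=0,1,2,\ldots$ there is $x_i^\infty\in C$ such that $$T_k\cdots T_ix^i\rightharpoonup x_i^\infty\quad\text{as }k\to\infty.$$ Then there is a point $x^\infty\in C$ such that $x_i^\infty\to x^\infty$ (as $i\to\infty$) and $x^k\rightharpoonup x^\infty$ (as $k\to\infty$). Moreover, $$|\langle y,x^{k+1}-x^\infty\rangle|\leq|\langle y,T_k\cdots T_ix^i-x_i^\infty\rangle|+2\|y\|\sum_{j=i}^\infty\beta_j\|v^j\|$$ holds for all $y\in\mathcal{H}$, all $i=0,1,2,\ldots$ and all $k\geq i$. If, in addition, for all $i=0,1,2,\ldots$, $$T_k\cdots T_ix^i\to x_i^\infty\quad\text{as }k\to\infty,$$ then $x^k\to x^\infty$. Moreover, in this case, $$\|x^{k+1}-x^\infty\|\leq\|T_k\cdots T_ix^i-x_i^\infty\|+2\sum_{j=i}^\infty\beta_j\|v^j\|$$ for all $i=0,1,2,\ldots$ and all $k\geq i$.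
   Context: $\rightharpoonup$ denotes weak convergence and $\to$ denotes norm convergence. An operator $T\colon\mathcal{H}\to\mathcal{H}$ is nonexpansive if $\|Tx-Ty\|\leq\|x-y\|$ for all $x,y\in\mathcal{H}$. $\operatorname{Fix}T$ is the set of fixed points of $T$. *)

theory Defs
  imports "HOL-Analysis.Analysis"
begin

definition nonexpansive :: "('a::real_normed_vector \<Rightarrow> 'a) \<Rightarrow> bool" where
  "nonexpansive T \<longleftrightarrow> (\<forall>x y. norm (T x - T y) \<le> norm (x - y))"

definition Fix :: "('a \<Rightarrow> 'a) \<Rightarrow> 'a set" where
  "Fix T = {x. T x = x}"

text \<open>Convergence in the weak topology of a real Hilbert space, that is, the topology induced
  by the functionals \<open>x \<mapsto> \<langle>y, x\<rangle>\<close>.\<close>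

definition weakly_tendsto :: "(nat \<Rightarrow> 'a::real_inner) \<Rightarrow> 'a \<Rightarrow> bool"  (infix "\<rightharpoonup>" 60) where
  "f \<rightharpoonup> l \<longleftrightarrow> (\<forall>y. (\<lambda>n. y \<bullet> f n) \<longlonglongrightarrow> y \<bullet> l)"

text \<open>For \<open>i \<le> k\<close>, \<open>comp_from_to T i k\<close> is the composition \<open>T\<^sub>k \<circ> \<dots> \<circ> T\<^sub>i\<close>, with \<open>T\<^sub>i\<close> applied first;
  for \<open>k < i\<close> it is the identity.\<close>

definition comp_from_to :: "(nat \<Rightarrow> 'a \<Rightarrow> 'a) \<Rightarrow> nat \<Rightarrow> nat \<Rightarrow> 'a \<Rightarrow> 'a" where
  "comp_from_to T i k = fold T [i..<Suc k]"

lemma comp_from_to_self: "comp_from_to T i i = T i"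
  by (simp add: comp_from_to_def)

lemma comp_from_to_Suc: "i \<le> Suc k \<Longrightarrow> comp_from_to T i (Suc k) = T (Suc k) \<circ> comp_from_to T i k"
  by (simp add: comp_from_to_def fun_eq_iff)

end

theory Submission
  imports Defs
begin

text \<open>
  Write \<open>e\<^sub>j = \<beta>\<^sub>j \<parallel>v\<^sup>j\<parallel>\<close>, a summable sequence, with tails \<open>r\<^sub>i = e\<^sub>i + e\<^sub>i\<^sub>+\<^sub>1 + \<dots> \<rightarrow> 0\<close>. The perturbed
  iterates stay close to each of the exact orbits \<open>T\<^sub>k \<dots> T\<^sub>i x\<^sup>i\<close>: by nonexpansiveness the \<open>j\<close>-th
  perturbation contributes at most \<open>e\<^sub>j\<close>, so \<open>\<parallel>x\<^sup>k\<^sup>+\<^sup>1 - T\<^sub>k \<dots> T\<^sub>i x\<^sup>i\<parallel> \<le> r\<^sub>i\<close> for all \<open>k \<ge> i\<close>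
  (\<open>perturbed_iterates_near_orbit\<close>).

  Two exact orbits started at times \<open>i\<close> and \<open>m\<close> are therefore eventually within \<open>r\<^sub>i + r\<^sub>m\<close> of each
  other. As the norm is weakly lower semicontinuous (\<open>weak_limit_norm_le\<close>), the same bound holds for
  their weak limits \<open>x\<^sub>i\<^sup>\<infinity>\<close> and \<open>x\<^sub>m\<^sup>\<infinity>\<close>. Hence the points \<open>x\<^sub>i\<^sup>\<infinity>\<close> form a Cauchy sequence in the closed
  set \<open>C\<close>, and its limit \<open>x\<^sup>\<infinity>\<close> satisfies \<open>\<parallel>x\<^sub>i\<^sup>\<infinity> - x\<^sup>\<infinity>\<parallel> \<le> r\<^sub>i\<close>. Both estimates of the theorem are the
  triangle inequality along \<open>x\<^sup>k\<^sup>+\<^sup>1\<close>, \<open>T\<^sub>k \<dots> T\<^sub>i x\<^sup>i\<close>, \<open>x\<^sub>i\<^sup>\<infinity>\<close>, \<open>x\<^sup>\<infinity>\<close>, and each of them yields the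
  corresponding convergence: \<open>i\<close> is taken large first, then \<open>k\<close>
  (\<open>tendsto_zero_two_step\<close>).
\<close>

lemma weak_limit_norm_le:
  fixes f :: "nat \<Rightarrow> 'a::real_inner"
  assumes "f \<rightharpoonup> l" and "eventually (\<lambda>n. norm (f n) \<le> c) sequentially"
  shows "norm l \<le> c"
proof (cases "l = 0")
  case True
  obtain n where "norm (f n) \<le> c"
    using assms(2) by (auto simp: eventually_sequentially)
  then show ?thesis using True order_trans[OF norm_ge_zero] by simp
next
  case False
  have "(\<lambda>n. l \<bullet> f n) \<longlonglongrightarrow> l \<bullet> l"
    using assms(1) by (simp add: weakly_tendsto_def)
  moreover have "eventually (\<lambda>n. l \<bullet> f n \<le> norm l * c) sequentially"
    using assms(2)
  proof eventually_elim
    case (elim n)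
    have "l \<bullet> f n \<le> norm l * norm (f n)" by (rule norm_cauchy_schwarz)
    also have "\<dots> \<le> norm l * c" using elim by (simp add: mult_left_mono)
    finally show ?case .
  qed
  ultimately have "l \<bullet> l \<le> norm l * c"
    by (rule tendsto_upperbound) simp
  then have "norm l * norm l \<le> norm l * c"
    by (simp add: dot_square_norm power2_eq_square)
  then show ?thesis using False by simp
qed

lemma weakly_tendsto_diff:
  assumes "f \<rightharpoonup> a" and "g \<rightharpoonup> b"
  shows "(\<lambda>n. f n - g n) \<rightharpoonup> (a - b)"
  using assms by (auto simp: weakly_tendsto_def inner_diff_right intro: tendsto_diff)

text \<open>The error \<open>r i\<close> does not vanish as \<open>k\<close> grows, so the index \<open>i\<close> has to be fixed, with \<open>r i\<close> small,
  before \<open>k\<close> is sent to infinity.\<close>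

lemma tendsto_zero_two_step:
  fixes a r :: "nat \<Rightarrow> real" and b :: "nat \<Rightarrow> nat \<Rightarrow> real"
  assumes nonneg: "\<And>k. 0 \<le> a k"
    and bound: "\<And>i k. i \<le> k \<Longrightarrow> a (Suc k) \<le> b i k + r i"
    and b: "\<And>i. b i \<longlonglongrightarrow> 0" and r: "r \<longlonglongrightarrow> 0"
  shows "a \<longlonglongrightarrow> 0"
proof -
  have "(\<lambda>k. a (Suc k)) \<longlonglongrightarrow> 0"
  proof (rule tendstoI)
    fix \<epsilon> :: real assume "\<epsilon> > 0"
    then have "eventually (\<lambda>i. r i < \<epsilon> / 2) sequentially"
      using r by (intro order_tendstoD(2)[of r 0]) auto
    then obtain i where i: "r i < \<epsilon> / 2"
      by (auto simp: eventually_sequentially)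
    have "eventually (\<lambda>k. b i k < \<epsilon> / 2) sequentially"
      using b[of i] \<open>\<epsilon> > 0\<close> by (intro order_tendstoD(2)[of "b i" 0]) auto
    then show "eventually (\<lambda>k. dist (a (Suc k)) 0 < \<epsilon>) sequentially"
      using eventually_ge_at_top[of i]
    proof eventually_elim
      case (elim k)
      then show ?case
        using bound[of i k] i nonneg[of "Suc k"] by (simp add: dist_real_def)
    qed
  qed
  then show ?thesis by (simp add: filterlim_sequentially_Suc)
qed

lemma summable_scaled_norm:
  fixes \<beta> :: "nat \<Rightarrow> real" and v :: "nat \<Rightarrow> 'a::real_normed_vector"
  assumes "\<And>k. \<beta> k \<ge> 0" and "summable \<beta>" and "bounded (range v)"
  shows "summable (\<lambda>k. \<beta> k * norm (v k))"
proof -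
  obtain B where "\<And>k. norm (v k) \<le> B"
    using assms(3) by (auto simp: bounded_iff)
  then show ?thesis
    using assms(1)
    by (intro summable_comparison_test'[OF summable_mult2[OF assms(2), of B], where N = 0])
       (simp add: abs_mult mult_left_mono)
qed

lemma perturbed_iterates_near_orbit:
  fixes T :: "nat \<Rightarrow> 'a::real_normed_vector \<Rightarrow> 'a"
  assumes T: "\<And>k. nonexpansive (T k)"
    and x: "\<And>k. x (Suc k) = T k (x k - u k)"
    and "i \<le> k"
  shows "norm (x (Suc k) - comp_from_to T i k (x i)) \<le> (\<Sum>j=i..k. norm (u j))"
  using \<open>i \<le> k\<close>
proof (induction k rule: dec_induct)
  case base
  have "norm (T i (x i - u i) - T i (x i)) \<le> norm ((x i - u i) - x i)"
    using T[of i] unfolding nonexpansive_def by blast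
  then show ?case by (simp add: comp_from_to_self x)
next
  case (step k)
  let ?P = "comp_from_to T i k (x i)"
  have "norm (x (Suc (Suc k)) - comp_from_to T i (Suc k) (x i))
      = norm (T (Suc k) (x (Suc k) - u (Suc k)) - T (Suc k) ?P)"
    using step.hyps by (simp add: comp_from_to_Suc x[of "Suc k"])
  also have "\<dots> \<le> norm ((x (Suc k) - u (Suc k)) - ?P)"
    using T[of "Suc k"] unfolding nonexpansive_def by blast
  also have "\<dots> = norm ((x (Suc k) - ?P) - u (Suc k))"
    by (simp add: algebra_simps)
  also have "\<dots> \<le> norm (x (Suc k) - ?P) + norm (u (Suc k))"
    by (rule norm_triangle_ineq4)
  also have "\<dots> \<le> (\<Sum>j=i..Suc k. norm (u j))"
    using step by simp
  finally show ?case .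
qed

lemma sum_le_tail:
  fixes e :: "nat \<Rightarrow> real"
  assumes "summable e" and "\<And>j. 0 \<le> e j" and "i \<le> k"
  shows "(\<Sum>j=i..k. e j) \<le> (\<Sum>j. e (j + i))"
proof -
  have "(\<Sum>j=i..k. e j) = (\<Sum>j\<in>{0..k - i}. e (j + i))"
    using sum.shift_bounds_cl_nat_ivl[of e 0 i "k - i"] assms(3) by simp
  also have "\<dots> \<le> (\<Sum>j. e (j + i))"
    using assms by (intro sum_le_suminf) (auto simp: summable_iff_shift)
  finally show ?thesis .
qed

text \<open>The Cauchy condition with an explicit modulus keeps its modulus in the limit.\<close>

lemma Cauchy_modulus_limit:
  fixes f :: "nat \<Rightarrow> 'a::{real_normed_vector, complete_space}"
  assumes f: "\<And>i m. norm (f i - f m) \<le> r i + r m" and r: "r \<longlonglongrightarrow> 0"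
  obtains l where "f \<longlonglongrightarrow> l" and "\<And>i. norm (f i - l) \<le> r i"
proof -
  have "Cauchy f"
  proof (rule metric_CauchyI)
    fix \<epsilon> :: real assume "\<epsilon> > 0"
    then have "eventually (\<lambda>i. r i < \<epsilon> / 2) sequentially"
      using r by (intro order_tendstoD(2)[of r 0]) auto
    then obtain N where N: "\<And>i. i \<ge> N \<Longrightarrow> r i < \<epsilon> / 2"
      by (auto simp: eventually_sequentially)
    have "dist (f i) (f m) < \<epsilon>" if "i \<ge> N" "m \<ge> N" for i m
      using f[of i m] N[OF that(1)] N[OF that(2)] by (simp add: dist_norm)
    then show "\<exists>M. \<forall>m\<ge>M. \<forall>n\<ge>M. dist (f m) (f n) < \<epsilon>" by blast
  qed
  then obtain l where l: "f \<longlonglongrightarrow> l"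
    using Cauchy_convergent convergent_def by blast
  have "norm (f i - l) \<le> r i" for i
  proof (rule LIMSEQ_le)
    show "(\<lambda>m. norm (f i - f m)) \<longlonglongrightarrow> norm (f i - l)"
      by (intro tendsto_intros l)
    show "(\<lambda>m. r i + r m) \<longlonglongrightarrow> r i"
      using tendsto_add[OF tendsto_const r, of "r i"] by simp
  qed (use f in blast)
  with l show thesis by (rule that)
qed

theorem corollary14:
  fixes T :: "nat \<Rightarrow> 'a::{real_inner, complete_space} \<Rightarrow> 'a"
    and C :: "'a set"
    and \<beta> :: "nat \<Rightarrow> real"
    and v x xlim :: "nat \<Rightarrow> 'a"
  assumes "\<And>k. nonexpansive (T k)"
    and "C \<subseteq> (\<Inter>k. Fix (T k))"
    and "C \<noteq> {}" and "closed C" and "convex C"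
    and "\<And>k. \<beta> k > 0" and "summable \<beta>"
    and "bounded (range v)"
    and "\<And>k. x (Suc k) = T k (x k - \<beta> k *\<^sub>R v k)"
    and "\<And>i. xlim i \<in> C"
    and "\<And>i. (\<lambda>k. comp_from_to T i k (x i)) \<rightharpoonup> xlim i"
  shows "\<exists>xinf\<in>C. xlim \<longlonglongrightarrow> xinf \<and> x \<rightharpoonup> xinf \<and>
    (\<forall>y i k. i \<le> k \<longrightarrow>
      \<bar>y \<bullet> (x (Suc k) - xinf)\<bar>
        \<le> \<bar>y \<bullet> (comp_from_to T i k (x i) - xlim i)\<bar>
          + 2 * norm y * (\<Sum>j. \<beta> (j + i) * norm (v (j + i)))) \<and>
    ((\<forall>i. (\<lambda>k. comp_from_to T i k (x i)) \<longlonglongrightarrow> xlim i) \<longrightarrow>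
      x \<longlonglongrightarrow> xinf \<and>
      (\<forall>i k. i \<le> k \<longrightarrow>
        norm (x (Suc k) - xinf)
          \<le> norm (comp_from_to T i k (x i) - xlim i)
            + 2 * (\<Sum>j. \<beta> (j + i) * norm (v (j + i)))))"
proof -
  define e where "e = (\<lambda>j. \<beta> j * norm (v j))"
  define r where "r = (\<lambda>i. \<Sum>j. e (j + i))"
  define P where "P = (\<lambda>i k. comp_from_to T i k (x i))"
  have e_nonneg: "0 \<le> e j" for j
    using assms(6)[of j] by (simp add: e_def)
  have e_summable: "summable e"
    unfolding e_def using summable_scaled_norm[of \<beta> v] assms(6-8) by (simp add: less_imp_le)
  have r_lim: "r \<longlonglongrightarrow> 0"
    unfolding r_def using suminf_exist_split2[OF e_summable] .
  have near: "norm (x (Suc k) - P i k) \<le> r i" if "i \<le> k" for i k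
  proof -
    have "norm (x (Suc k) - P i k) \<le> (\<Sum>j=i..k. norm (\<beta> j *\<^sub>R v j))"
      unfolding P_def using assms(1,9) that
      by (intro perturbed_iterates_near_orbit[where u = "\<lambda>j. \<beta> j *\<^sub>R v j"]) auto
    also have "\<dots> = (\<Sum>j=i..k. e j)"
      using assms(6) by (simp add: e_def less_imp_le)
    also have "\<dots> \<le> r i"
      unfolding r_def by (rule sum_le_tail[OF e_summable e_nonneg that])
    finally show ?thesis .
  qed
  have weak: "P i \<rightharpoonup> xlim i" for i
    using assms(11)[of i] by (simp add: P_def)
  have limits_close: "norm (xlim i - xlim m) \<le> r i + r m" for i m
  proof (rule weak_limit_norm_le[OF weakly_tendsto_diff[OF weak weak]])
    show "eventually (\<lambda>k. norm (P i k - P m k) \<le> r i + r m) sequentially"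
      using eventually_ge_at_top[of "max i m"]
    proof eventually_elim
      case (elim k)
      have "norm (P i k - P m k) \<le> norm (x (Suc k) - P i k) + norm (x (Suc k) - P m k)"
        using norm_triangle_ineq4[of "x (Suc k) - P m k" "x (Suc k) - P i k"] by simp
      then show ?case using near[of i k] near[of m k] elim by simp
    qed
  qed
  obtain xinf where lim: "xlim \<longlonglongrightarrow> xinf" and rate: "\<And>i. norm (xlim i - xinf) \<le> r i"
    using Cauchy_modulus_limit[of xlim r, OF limits_close r_lim] by blast
  have "xinf \<in> C"
    using closed_sequentially[OF assms(4) _ lim] assms(10) by blast
  have split: "x (Suc k) - xinf = (P i k - xlim i) + ((x (Suc k) - P i k) + (xlim i - xinf))" for i k
    by simp
  have rest: "norm ((x (Suc k) - P i k) + (xlim i - xinf)) \<le> 2 * r i" if "i \<le> k" for i k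
    using norm_triangle_ineq[of "x (Suc k) - P i k" "xlim i - xinf"] near[OF that] rate[of i]
    by linarith
  have weak_est: "\<bar>y \<bullet> (x (Suc k) - xinf)\<bar> \<le> \<bar>y \<bullet> (P i k - xlim i)\<bar> + 2 * norm y * r i"
    if "i \<le> k" for y i k
  proof -
    let ?d = "(x (Suc k) - P i k) + (xlim i - xinf)"
    have "\<bar>y \<bullet> ?d\<bar> \<le> norm y * norm ?d" by (rule Cauchy_Schwarz_ineq2)
    also have "\<dots> \<le> norm y * (2 * r i)" by (intro mult_left_mono rest that) simp
    finally have "\<bar>y \<bullet> ?d\<bar> \<le> 2 * norm y * r i" by (simp only: mult_ac)
    moreover have "y \<bullet> (x (Suc k) - xinf) = y \<bullet> (P i k - xlim i) + y \<bullet> ?d"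
      by (subst split[of k i]) (rule inner_add_right)
    ultimately show ?thesis by linarith
  qed
  have norm_est: "norm (x (Suc k) - xinf) \<le> norm (P i k - xlim i) + 2 * r i"
    if "i \<le> k" for i k
    using norm_triangle_ineq[of "P i k - xlim i" "(x (Suc k) - P i k) + (xlim i - xinf)"]
      rest[OF that] unfolding split[of k i, symmetric] by linarith
  have "x \<rightharpoonup> xinf"
    unfolding weakly_tendsto_def
  proof
    fix y
    have "(\<lambda>k. \<bar>y \<bullet> (x k - xinf)\<bar>) \<longlonglongrightarrow> 0"
    proof (rule tendsto_zero_two_step)
      show "(\<lambda>k. \<bar>y \<bullet> (P i k - xlim i)\<bar>) \<longlonglongrightarrow> 0" for i
        using weak[of i] unfolding weakly_tendsto_def inner_diff_right
        by (intro tendsto_rabs_zero) (simp add: LIM_zero)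
      show "(\<lambda>i. 2 * norm y * r i) \<longlonglongrightarrow> 0"
        by (rule tendsto_mult_right_zero[OF r_lim])
    qed (use weak_est in simp_all)
    then show "(\<lambda>k. y \<bullet> x k) \<longlonglongrightarrow> y \<bullet> xinf"
      by (simp add: tendsto_rabs_zero_iff inner_diff_right LIM_zero_iff)
  qed
  moreover have "x \<longlonglongrightarrow> xinf" if strong: "\<And>i. P i \<longlonglongrightarrow> xlim i"
  proof -
    have "(\<lambda>k. norm (x k - xinf)) \<longlonglongrightarrow> 0"
    proof (rule tendsto_zero_two_step)
      show "(\<lambda>k. norm (P i k - xlim i)) \<longlonglongrightarrow> 0" for i
        using strong[of i] by (simp add: tendsto_norm_zero LIM_zero)
      show "(\<lambda>i. 2 * r i) \<longlonglongrightarrow> 0"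
        by (rule tendsto_mult_right_zero[OF r_lim])
    qed (use norm_est in simp_all)
    then show ?thesis
      by (simp add: tendsto_norm_zero_iff LIM_zero_iff)
  qed
  ultimately show ?thesis
    using lim weak_est norm_est unfolding P_def r_def e_def
    by (intro bexI[OF _ \<open>xinf \<in> C\<close>] conjI allI impI) auto
qed

end
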